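(* Let $Z$ be an ICLP with mean $0$ and covariance operator $C$, let $\sigma>0$, and let $f,g\in\mathbb{H}$. Let $P_f$ and $P_g$ denote the laws on the Borel $\sigma$-algebra of $\mathbb{H}$ of $f+\sigma Z$ and $g+\sigma Z$ respectively. Then $P_f$ and $P_g$ are mutually absolutely continuous (equivalent) if and only if $f-g\in\mathcal{H}_C$. In particular, for a functional summary $D\mapsto f_D\in\mathbb{H}$ and adjacent datasets $D,D'$, the laws $P_D,P_{D'}$ of $f_D+\sigma Z$, $f_{D'}+\sigma Z$ are equivalent iff $f_D-f_{D'}\in\mathcal{H}_C$.
   Context: $\mathbb{H}$ is a real separable infinite-dimensional Hilbert space. $C$ is a covariance operator on $\mathbb{H}$ (self-adjoint, positive semidefinite, trace class) with eigenvalues $\lambda_1\ge\lambda_2\ge\dots>0$ and eigenvectors $\{\phi_j\}_{j\ge1}$ forming an orthonormal basis of $\mathbb{H}$. For $h\in\mathbb{H}$ write $h_j=\langle h,\phi_j\rangle$. Define $\|h\|_C=\big(\sum_{j\ge1}h_j^2/\lambda_j\big)^{1/2}$ and $\mathcal{H}_C=\{h\in\mathbb{H}:\|h\|_C<\infty\}$. An ICLP with mean $\mu$ and covariance operator $C$ is the random element $\mu+\sum_{j\ge1}\sqrt{\lambda_j}Z_j\phi_j$ (series converging in $L^2(\Omega;\mathbb{H})$), where $Z_j$ are i.i.d. Laplace with mean $0$ and variance $1$, i.e. with density $\frac1{\sqrt2}e^{-\sqrt2|x|}$. Datasets are elements of a collection $\mathcal{D}$ of $n$-record databases; $D,D'$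 are adjacent if they differ in exactly one record. *)

theory Defs
  imports "HOL-Probability.Probability"
begin

text \<open>Orthonormal basis of a real Hilbert space indexed by the naturals
 (this encodes separability and infinite dimensionality).\<close>
definition orthonormal_basis :: "(nat \<Rightarrow> 'a::real_inner) \<Rightarrow> bool" where
  "orthonormal_basis phi \<longleftrightarrow>
     (\<forall>i j. phi i \<bullet> phi j = (if i = j then 1 else 0)) \<and>
     closure (span (range phi)) = UNIV"

text \<open>Covariance operator C given by its spectral data: eigenvalues lam
 (non-increasing, strictly positive, summable = trace class) with eigenvectors phi
 forming an orthonormal basis; C h = sum_j lam j (h . phi j) phi j.\<close>
definition covariance_spectral :: "(nat \<Rightarrow> real) \<Rightarrow> (nat \<Rightarrow> 'a::real_inner) \<Rightarrow> bool" where
  "covariance_spectral lam phi \<longleftrightarrow>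
     orthonormal_basis phi \<and> (\<forall>j. lam j > 0) \<and> decseq lam \<and> summable lam"

definition cov_op :: "(nat \<Rightarrow> real) \<Rightarrow> (nat \<Rightarrow> 'a::real_inner) \<Rightarrow> 'a \<Rightarrow> 'a" where
  "cov_op lam phi h = (\<Sum>j. (lam j * (h \<bullet> phi j)) *\<^sub>R phi j)"

definition in_HC :: "(nat \<Rightarrow> real) \<Rightarrow> (nat \<Rightarrow> 'a::real_inner) \<Rightarrow> 'a \<Rightarrow> bool" where
  "in_HC lam phi h \<longleftrightarrow> summable (\<lambda>j. (h \<bullet> phi j)\<^sup>2 / lam j)"

text \<open>Density of the Laplace law with mean 0 and variance 1.\<close>
definition laplace_density :: "real \<Rightarrow> ennreal" where
  "laplace_density x = ennreal (exp (- sqrt 2 * \<bar>x\<bar>) / sqrt 2)"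

definition ICLP :: "'m measure \<Rightarrow> (nat \<Rightarrow> real) \<Rightarrow> (nat \<Rightarrow> 'a::{real_inner,complete_space})
                    \<Rightarrow> 'a \<Rightarrow> ('m \<Rightarrow> 'a) \<Rightarrow> bool" where
  "ICLP M lam phi mu Z \<longleftrightarrow>
     prob_space M \<and> covariance_spectral lam phi \<and>
     Z \<in> borel_measurable M \<and>
     (\<exists>Zs :: nat \<Rightarrow> 'm \<Rightarrow> real.
        prob_space.indep_vars M (\<lambda>_. borel) Zs UNIV \<and>
        (\<forall>j. distributed M lborel (Zs j) laplace_density) \<and>
        (\<lambda>n. \<integral>\<^sup>+ \<omega>. ennreal ((norm (Z \<omega> - (mu + (\<Sum>j<n. (sqrt (lam j) * Zs j \<omega>) *\<^sub>R phi j))))\<^sup>2) \<partial>M)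
          \<longlonglongrightarrow> 0)"

definition equivalent_measures :: "'a measure \<Rightarrow> 'a measure \<Rightarrow> bool" where
  "equivalent_measures P Q \<longleftrightarrow> absolutely_continuous P Q \<and> absolutely_continuous Q P"

end

theory Submission
  imports Defs
begin

text \<open>
  In the normalised coordinates \<open>((x - g) \<bullet> phi j) / (sigma * sqrt (lam j))\<close> the law of \<open>g + sigma Z\<close> is
  the product of countably many Laplace laws, the law of \<open>f + sigma Z\<close> is its translate by the
  sequence \<open>a j = ((f - g) \<bullet> phi j) / (sigma * sqrt (lam j))\<close>, and these coordinates generate the
  Borel sets of the Hilbert space. It remains to show that the translate by \<open>a\<close> is absolutely
  continuous iff \<open>a\<close> is square summable, a case of Kakutani's dichotomy.

  If \<open>a\<close> is square summable, the likelihood ratios of the translates by the first \<open>n\<close> coordinates of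
  \<open>a\<close> are bounded in \<open>L\<^sup>2\<close>, because the Laplace likelihood ratio lies within \<open>exp (sqrt 2 * \<bar>a j\<bar>) - 1\<close>
  of 1. So the translates of open sets of small measure have uniformly small measure; this passes to
  the full translate by Fatou's lemma, and outer regularity gives absolute continuity.
  If \<open>a\<close> is not square summable, the Hellinger affinities of the first \<open>n\<close> coordinates tend to 0. Along
  a subsequence the square roots of the likelihood ratios are then summable almost everywhere for the
  product law, and their inverses are so for the translate, which excludes absolute continuity.
\<close>

section \<open>The Laplace law and its translates\<close>

definition laplace :: "real measure" where
  "laplace = density lborel laplace_density"

lemma measurable_laplace_density [measurable]: "laplace_density \<in> borel_measurable borel"
  unfolding laplace_density_def [abs_def] by measurable

lemma sets_laplace [measurable_cong, simp]: "sets laplace = sets borel"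
  by (simp add: laplace_def)

lemma space_laplace [simp]: "space laplace = UNIV"
  by (simp add: laplace_def)

lemma nn_integral_laplace:
  fixes h :: "real \<Rightarrow> ennreal"
  assumes [measurable]: "h \<in> borel_measurable borel"
  shows "(\<integral>\<^sup>+x. h x \<partial>laplace) = (\<integral>\<^sup>+x. laplace_density x * h x \<partial>lborel)"
  unfolding laplace_def by (rule nn_integral_density) auto

lemma nn_integral_laplace_uminus:
  fixes h :: "real \<Rightarrow> ennreal"
  assumes [measurable]: "h \<in> borel_measurable borel"
  shows "(\<integral>\<^sup>+x. h (- x) \<partial>laplace) = (\<integral>\<^sup>+x. h x \<partial>laplace)"
proof -
  have "(\<integral>\<^sup>+x. laplace_density x * h x \<partial>lborel) = (\<integral>\<^sup>+x. laplace_density (- x) * h (- x) \<partial>lborel)"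
    using nn_integral_real_affine[of "\<lambda>x. laplace_density x * h x" "-1" 0] by simp
  then show ?thesis
    by (simp add: nn_integral_laplace laplace_density_def)
qed

text \<open>The density is the average of the exponential density of rate \<open>sqrt 2\<close> and
  its mirror image, both of mass 1. At 0 the two halves overlap and the identity fails, so it is
  used almost everywhere.\<close>

lemma prob_space_laplace: "prob_space laplace"
proof
  let ?e = "\<lambda>x. ennreal (exponential_density (sqrt 2) x)"
  have e1: "(\<integral>\<^sup>+x. ?e x \<partial>lborel) = 1"
    using prob_space.emeasure_space_1[OF prob_space_exponential_density[of "sqrt 2"]]
    by (simp add: emeasure_density)
  have e2: "(\<integral>\<^sup>+x. ?e (- x) \<partial>lborel) = 1"
    using nn_integral_real_affine[of ?e "-1" 0] e1 by simp
  have "(\<integral>\<^sup>+x. laplace_density x \<partial>lborel) = (\<integral>\<^sup>+x. ennreal (1/2) * (?e x + ?e (- x)) \<partial>lborel)"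
  proof (rule nn_integral_cong_AE)
    have "AE x in lborel. x \<noteq> (0::real)"
      by (rule AE_lborel_singleton)
    then show "AE x in lborel. laplace_density x = ennreal (1/2) * (?e x + ?e (- x))"
    proof eventually_elim
      case (elim x)
      have "1 / sqrt 2 = sqrt 2 / (2::real)" by (simp add: real_div_sqrt field_simps)
      then have "exp (- sqrt 2 * \<bar>x\<bar>) / sqrt 2
          = 1/2 * (exponential_density (sqrt 2) x + exponential_density (sqrt 2) (- x))"
        using elim by (simp add: exponential_density_def field_simps abs_if)
      then show ?case
        unfolding laplace_density_def
        by (simp only:) (subst ennreal_mult, auto simp: exponential_density_nonneg ennreal_plus)
    qed
  qed
  also have "\<dots> = ennreal (1/2) * (1 + 1)"
    by (subst nn_integral_cmult) (auto simp: nn_integral_add e1 e2)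
  also have "\<dots> = ennreal (1/2) * ennreal 2"
    by simp
  also have "\<dots> = 1"
    by (subst ennreal_mult[symmetric]) auto
  finally show "emeasure laplace (space laplace) = 1"
    by (simp add: laplace_def emeasure_density)
qed

interpretation laplace: prob_space laplace
  by (rule prob_space_laplace)

text \<open>Reflection gives the two half lines equal mass, and together they cover the
  line.\<close>

lemma laplace_half_line: "1/2 \<le> laplace.prob {..0}" "1/2 \<le> laplace.prob {0..}"
proof -
  have "emeasure laplace {..0} = emeasure laplace {0..}"
    using nn_integral_laplace_uminus[of "indicator {0..}"]
    by (simp add: indicator_def flip: nn_integral_indicator)
  then have eq: "laplace.prob {..0} = laplace.prob {0..}"
    by (simp add: measure_def)
  have "{..0} \<union> {0..} = (UNIV :: real set)" by auto
  then have "1 \<le> laplace.prob {..0} + laplace.prob {0..}"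
    using measure_Un_le[of "{..0}" laplace "{0..}"] laplace.prob_space by simp
  with eq show "1/2 \<le> laplace.prob {..0}" "1/2 \<le> laplace.prob {0..}" by auto
qed

text \<open>The density of the Laplace law translated by \<open>a\<close> with respect to the Laplace law.\<close>
definition lratio :: "real \<Rightarrow> real \<Rightarrow> real" where
  "lratio a x = exp (sqrt 2 * (\<bar>x\<bar> - \<bar>x - a\<bar>))"

text \<open>Its integral under \<open>laplace\<close> is the Hellinger affinity between the Laplace
  law and its translate.\<close>

definition sqrt_lratio :: "real \<Rightarrow> real \<Rightarrow> real" where
  "sqrt_lratio a x = exp ((\<bar>x\<bar> - \<bar>x - a\<bar>) / sqrt 2)"

lemma measurable_lratio [measurable]: "lratio a \<in> borel_measurable borel"
  unfolding lratio_def [abs_def] by measurable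

lemma measurable_sqrt_lratio [measurable]: "sqrt_lratio a \<in> borel_measurable borel"
  unfolding sqrt_lratio_def [abs_def] by measurable

lemma lratio_pos: "0 < lratio a x" by (simp add: lratio_def)

lemma sqrt_lratio_pos: "0 < sqrt_lratio a x" by (simp add: sqrt_lratio_def)

lemma sqrt_lratio_power2: "(sqrt_lratio a x)\<^sup>2 = lratio a x"
proof -
  have "2 / sqrt 2 = sqrt (2::real)" by (simp add: real_div_sqrt)
  then show ?thesis
    by (simp add: sqrt_lratio_def lratio_def flip: exp_double) (simp add: field_simps)
qed

text \<open>At a translated point the root ratio is the inverse of the root ratio of the opposite
  translation. Smallness under the translate can thus be read off an integral under
  \<open>laplace\<close> with \<open>- a\<close>.\<close>

lemma sqrt_lratio_shift: "sqrt_lratio a (x + a) * sqrt_lratio (- a) x = 1"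
  by (simp add: sqrt_lratio_def flip: exp_add add_divide_distrib)

lemma lratio_le: "lratio a x \<le> exp (sqrt 2 * \<bar>a\<bar>)"
  unfolding lratio_def by (intro exp_le_cancel_iff[THEN iffD2] mult_left_mono) auto

lemma lratio_ge: "exp (- (sqrt 2 * \<bar>a\<bar>)) \<le> lratio a x"
proof -
  have "sqrt 2 * (- \<bar>a\<bar>) \<le> sqrt 2 * (\<bar>x\<bar> - \<bar>x - a\<bar>)"
    by (rule mult_left_mono) auto
  then show ?thesis by (simp add: lratio_def)
qed

lemma abs_lratio_minus_1_le: "\<bar>lratio a x - 1\<bar> \<le> exp (sqrt 2 * \<bar>a\<bar>) - 1"
proof -
  define t where "t = exp (sqrt 2 * \<bar>a\<bar>)"
  have t: "1 \<le> t" by (simp add: t_def)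
  \<comment> \<open>The deviation of the ratio below 1 is at most \<open>1 - 1 / t\<close>; this
    inequality lets the upper deviation \<open>t - 1\<close> serve on both sides.\<close>
  have "1 - 1 / t \<le> t - 1"
  proof -
    have "0 \<le> (t - 1)\<^sup>2 / t" using t by simp
    also have "(t - 1)\<^sup>2 / t = t - 2 + 1 / t" using t by (simp add: field_simps power2_eq_square)
    finally show ?thesis by simp
  qed
  moreover have "1 / t \<le> lratio a x"
    using lratio_ge[of a x] by (simp add: t_def exp_minus field_simps)
  ultimately show ?thesis using lratio_le[of a x] by (simp add: t_def)
qed

lemma nn_integral_lratio:
  fixes h :: "real \<Rightarrow> ennreal"
  assumes [measurable]: "h \<in> borel_measurable borel"
  shows "(\<integral>\<^sup>+x. ennreal (lratio a x) * h x \<partial>laplace) = (\<integral>\<^sup>+x. h (x + a) \<partial>laplace)"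
proof -
  have *: "laplace_density x * ennreal (lratio a x) = laplace_density (x - a)" for x
  proof -
    have "exp (- sqrt 2 * \<bar>x\<bar>) / sqrt 2 * lratio a x = exp (- sqrt 2 * \<bar>x - a\<bar>) / sqrt 2"
      by (simp add: lratio_def algebra_simps flip: exp_add)
    then show ?thesis
      by (simp add: laplace_density_def lratio_def flip: ennreal_mult)
  qed
  have "(\<integral>\<^sup>+x. ennreal (lratio a x) * h x \<partial>laplace) = (\<integral>\<^sup>+x. laplace_density (x - a) * h x \<partial>lborel)"
    by (simp add: nn_integral_laplace * flip: mult.assoc)
  also have "\<dots> = (\<integral>\<^sup>+x. laplace_density x * h (x + a) \<partial>lborel)"
    using nn_integral_real_affine[of "\<lambda>x. laplace_density (x - a) * h x" 1 a] by (simp add: add.commute)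
  also have "\<dots> = (\<integral>\<^sup>+x. h (x + a) \<partial>laplace)"
    by (simp add: nn_integral_laplace)
  finally show ?thesis .
qed

lemma integrable_lratio [simp]: "integrable laplace (lratio a)"
  using lratio_le[of a] lratio_pos[of a]
  by (intro laplace.integrable_const_bound[where B = "exp (sqrt 2 * \<bar>a\<bar>)"]) (auto simp: less_imp_le abs_of_pos)

lemma integral_lratio: "laplace.expectation (lratio a) = 1"
  using nn_integral_lratio[of "\<lambda>_. 1" a] laplace.emeasure_space_1
  by (simp add: nn_integral_eq_integral lratio_pos less_imp_le)

text \<open>As the ratio has mean 1, its second moment is 1 plus its variance. The bound is put in
  exponential form so that products over coordinates become exponentials of sums.\<close>

lemma nn_integral_lratio_power2_le:
  "(\<integral>\<^sup>+x. (lratio a x)\<^sup>2 \<partial>laplace) \<le> ennreal (exp ((exp (sqrt 2 * \<bar>a\<bar>) - 1)\<^sup>2))"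
proof -
  let ?B = "exp (sqrt 2 * \<bar>a\<bar>) - 1"
  have int: "integrable laplace (\<lambda>x. (lratio a x - 1)\<^sup>2)"
    using abs_lratio_minus_1_le[of a]
    by (intro laplace.integrable_const_bound[where B = "?B\<^sup>2"]) (auto simp: abs_le_square_iff[symmetric])
  have le: "laplace.expectation (\<lambda>x. (lratio a x - 1)\<^sup>2) \<le> ?B\<^sup>2"
    using abs_lratio_minus_1_le[of a] int
    by (intro laplace.integral_le_const) (auto simp: abs_le_square_iff[symmetric])
  have eq: "(lratio a x)\<^sup>2 = (lratio a x - 1)\<^sup>2 + 2 * lratio a x - 1" for x
    by (simp add: power2_eq_square algebra_simps)
  have int': "integrable laplace (\<lambda>x. (lratio a x)\<^sup>2)"
    unfolding eq using int by simp
  have "laplace.expectation (\<lambda>x. (lratio a x)\<^sup>2) = laplace.expectation (\<lambda>x. (lratio a x - 1)\<^sup>2) + 1"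
    unfolding eq using int by (simp add: integral_lratio laplace.prob_space[simplified])
  also have "\<dots> \<le> exp (?B\<^sup>2)"
    using le exp_ge_add_one_self[of "?B\<^sup>2"] by linarith
  finally show ?thesis
    using int' by (subst nn_integral_eq_integral) (auto intro!: ennreal_leI)
qed

text \<open>With \<open>s = sqrt_lratio a\<close> and \<open>E (s\<^sup>2) = 1\<close> one has \<open>1 - E s = E ((1 - s)\<^sup>2) / 2\<close>, and \<open>s\<close> is
  constantly \<open>exp (- \<bar>a\<bar> / sqrt 2)\<close> on the half line of probability \<open>1/2\<close> pointing away from \<open>a\<close>.\<close>
lemma nn_integral_sqrt_lratio_le:
  "(\<integral>\<^sup>+x. sqrt_lratio a x \<partial>laplace) \<le> ennreal (exp (- ((1 - exp (- \<bar>a\<bar> / sqrt 2))\<^sup>2 / 4)))"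
proof -
  let ?d = "(1 - exp (- \<bar>a\<bar> / sqrt 2))\<^sup>2"
  have int: "integrable laplace (sqrt_lratio a)"
    using integrable_lratio[of a] unfolding sqrt_lratio_power2[symmetric]
    by (rule laplace.square_integrable_imp_integrable[rotated]) auto
  have int2: "integrable laplace (\<lambda>x. (1 - sqrt_lratio a x)\<^sup>2)"
    unfolding power2_diff sqrt_lratio_power2 using int by auto
  define H :: "real set" where "H = (if 0 \<le> a then {..0} else {0..})"
  have [measurable]: "H \<in> sets borel" by (simp add: H_def)
  have "?d * (1/2) \<le> ?d * laplace.prob H"
    using laplace_half_line by (intro mult_left_mono) (auto simp: H_def)
  also have "\<dots> = laplace.expectation (\<lambda>x. ?d * indicator H x)"
    by simp
  also have "\<dots> \<le> laplace.expectation (\<lambda>x. (1 - sqrt_lratio a x)\<^sup>2)"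
  proof (rule integral_mono[OF _ int2])
    show "?d * indicator H x \<le> (1 - sqrt_lratio a x)\<^sup>2" for x
    proof (cases "x \<in> H")
      case True
      then have "\<bar>x\<bar> - \<bar>x - a\<bar> = - \<bar>a\<bar>" by (auto simp: H_def split: if_splits)
      then show ?thesis using True by (simp add: sqrt_lratio_def)
    qed simp
  qed (auto intro: laplace.integrable_const_bound[where B = 1])
  also have "\<dots> = 2 - 2 * laplace.expectation (sqrt_lratio a)"
    unfolding power2_diff sqrt_lratio_power2 using int by (simp add: integral_lratio laplace.prob_space[simplified])
  finally have "laplace.expectation (sqrt_lratio a) \<le> 1 + (- (?d / 4))" by simp
  also have "\<dots> \<le> exp (- (?d / 4))" by (rule exp_ge_add_one_self)
  finally show ?thesis
    using int sqrt_lratio_pos[of a] by (subst nn_integral_eq_integral) (auto simp: less_imp_le intro!: ennreal_leI)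
qed

section \<open>Translates of the infinite product of Laplace laws\<close>

definition laplace_seq :: "(nat \<Rightarrow> real) measure" where
  "laplace_seq = Pi\<^sub>M UNIV (\<lambda>_. laplace)"

lemma sets_laplace_seq [measurable_cong, simp]: "sets laplace_seq = sets borel"
proof -
  have "sets laplace_seq = sets (Pi\<^sub>M UNIV (\<lambda>_::nat. borel :: real measure))"
    unfolding laplace_seq_def by (rule sets_PiM_cong) auto
  then show ?thesis by (simp add: sets_PiM_equal_borel)
qed

lemma space_laplace_seq [simp]: "space laplace_seq = UNIV"
  using sets_eq_imp_space_eq[OF sets_laplace_seq] by simp

interpretation laplace_seq: prob_space laplace_seq
  unfolding laplace_seq_def by (rule prob_space_PiM) (rule prob_space_laplace)

lemma measurable_seq_component [measurable]: "(\<lambda>w::nat \<Rightarrow> real. w j) \<in> borel_measurable borel"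
  by (rule borel_measurable_continuous_onI) simp

lemma measurable_seq_add [measurable]:
  "(\<lambda>w j. w j + c j) \<in> borel_measurable (borel :: (nat \<Rightarrow> real) measure)"
  by (rule measurable_coordinatewise_then_product) measurable

text \<open>The integrand depends only on the coordinates in \<open>J\<close>, whose joint law is
  the finite product, where the integral factors.\<close>

lemma nn_integral_laplace_seq_prod:
  assumes "finite J" and h [measurable]: "\<And>j. h j \<in> borel_measurable borel"
  shows "(\<integral>\<^sup>+w. (\<Prod>j\<in>J. h j (w j)) \<partial>laplace_seq) = (\<Prod>j\<in>J. \<integral>\<^sup>+x. h j x \<partial>laplace)"
proof -
  interpret product_prob_space "\<lambda>_::nat. laplace" UNIV
    by unfold_locales
  have hl: "h j \<in> borel_measurable laplace" for j
    using h by (simp add: measurable_cong_sets[OF sets_laplace refl])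
  have hJ: "(\<lambda>w. \<Prod>j\<in>J. h j (w j)) \<in> borel_measurable (Pi\<^sub>M J (\<lambda>_. laplace))"
    by (intro borel_measurable_prod_ennreal measurable_compose[OF _ hl] measurable_component_singleton)
  have "(\<Prod>j\<in>J. \<integral>\<^sup>+x. h j x \<partial>laplace) = (\<integral>\<^sup>+w. (\<Prod>j\<in>J. h j (w j)) \<partial>Pi\<^sub>M J (\<lambda>_. laplace))"
    using assms(1) hl by (subst product_nn_integral_prod) simp_all
  also have "Pi\<^sub>M J (\<lambda>_. laplace) = distr laplace_seq (Pi\<^sub>M J (\<lambda>_. laplace)) (\<lambda>w. restrict w J)"
    unfolding laplace_seq_def using assms(1) by (subst distr_PiM_restrict_finite) auto
  also have "(\<integral>\<^sup>+w. (\<Prod>j\<in>J. h j (w j)) \<partial>\<dots>) = (\<integral>\<^sup>+w. (\<Prod>j\<in>J. h j (restrict w J j)) \<partial>laplace_seq)"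
    unfolding laplace_seq_def
    by (rule nn_integral_distr) (auto intro!: measurable_restrict_subset hJ)
  finally show ?thesis by simp
qed

text \<open>Translating finitely many coordinates leaves an explicit density; the full translate is
  reached later as a limit. Both sides are compared on cylinder sets, which determine them.\<close>

lemma distr_laplace_seq_finite_shift:
  "distr laplace_seq borel (\<lambda>w j. w j + (if j < n then a j else 0))
     = density laplace_seq (\<lambda>w. \<Prod>j<n. ennreal (lratio (a j) (w j)))" (is "?P = ?Q")
proof (rule measure_eqI_PiM_infinite[where I = UNIV and M = "\<lambda>_. laplace"])
  show "sets ?P = sets (Pi\<^sub>M UNIV (\<lambda>_. laplace))" "sets ?Q = sets (Pi\<^sub>M UNIV (\<lambda>_. laplace))"
    by (simp_all flip: laplace_seq_def)
  show "finite_measure ?P"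
    by (intro prob_space.finite_measure laplace_seq.prob_space_distr) simp
next
  fix A :: "nat \<Rightarrow> real set" and J :: "nat set"
  assume J: "finite J" and A: "\<And>i. i \<in> J \<Longrightarrow> A i \<in> sets laplace"
  define X where "X = prod_emb UNIV (\<lambda>_. laplace) J (Pi\<^sub>E J A)"
  \<comment> \<open>\<open>K\<close> contains the constrained coordinates and the translated ones.
    \<open>B\<close> is padded with \<open>UNIV\<close> and \<open>c\<close> with 0, so the added
    factors are 1.\<close>
  define K where "K = J \<union> {..<n}"
  define B where "B j = (if j \<in> J then A j else UNIV)" for j
  define c where "c j = (if j < n then a j else 0)" for j
  have K: "finite K" using J by (simp add: K_def)
  have [measurable]: "B j \<in> sets borel" for j using A by (simp add: B_def)
  have X_eq: "X = (\<Inter>j\<in>K. (\<lambda>w. w j) -` B j)"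
    by (auto simp: X_def K_def B_def prod_emb_def PiE_def Pi_def split: if_splits)
  have [measurable]: "X \<in> sets borel"
    unfolding X_eq using K
    by (cases "K = {}") (auto intro!: sets.finite_INT measurable_sets_borel[OF measurable_seq_component])
  have ind: "indicator X w = (\<Prod>j\<in>K. indicator (B j) (w j) :: ennreal)" for w
    using K by (auto simp: X_eq indicator_def prod_eq_1_iff intro!: prod_zero)
  have "emeasure ?P X = (\<integral>\<^sup>+w. indicator X (\<lambda>j. w j + c j) \<partial>laplace_seq)"
    by (simp add: nn_integral_distr c_def flip: nn_integral_indicator)
  also have "\<dots> = (\<Prod>j\<in>K. \<integral>\<^sup>+x. indicator (B j) (x + c j) \<partial>laplace)"
    unfolding ind by (rule nn_integral_laplace_seq_prod[OF K]) measurable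
  also have "\<dots> = (\<Prod>j\<in>K. \<integral>\<^sup>+x. ennreal (lratio (c j) x) * indicator (B j) x \<partial>laplace)"
    by (simp add: nn_integral_lratio)
  also have "\<dots> = (\<integral>\<^sup>+w. (\<Prod>j\<in>K. ennreal (lratio (c j) (w j)) * indicator (B j) (w j)) \<partial>laplace_seq)"
    by (rule nn_integral_laplace_seq_prod[OF K, symmetric]) measurable
  also have "\<dots> = (\<integral>\<^sup>+w. (\<Prod>j<n. ennreal (lratio (a j) (w j))) * indicator X w \<partial>laplace_seq)"
  proof (intro nn_integral_cong)
    fix w
    have "(\<Prod>j<n. ennreal (lratio (a j) (w j))) = (\<Prod>j\<in>K. ennreal (lratio (c j) (w j)))"
      using K by (intro prod.mono_neutral_cong_left) (auto simp: K_def c_def lratio_def)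
    then show "(\<Prod>j\<in>K. ennreal (lratio (c j) (w j)) * indicator (B j) (w j))
        = (\<Prod>j<n. ennreal (lratio (a j) (w j))) * indicator X w"
      by (simp add: ind prod.distrib)
  qed
  also have "\<dots> = emeasure ?Q X"
    by (simp add: emeasure_density)
  finally show "emeasure ?P (prod_emb UNIV (\<lambda>_. laplace) J (Pi\<^sub>E J A))
      = emeasure ?Q (prod_emb UNIV (\<lambda>_. laplace) J (Pi\<^sub>E J A))"
    by (simp add: X_def)
qed

section \<open>Translates by square summable sequences\<close>

lemma tendsto_finite_shift:
  fixes w a :: "nat \<Rightarrow> real"
  shows "(\<lambda>n j. w j + (if j < n then a j else 0)) \<longlonglongrightarrow> (\<lambda>j. w j + a j)"
proof -
  have "(\<lambda>n. w j + (if j < n then a j else 0)) \<longlonglongrightarrow> w j + a j" for j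
    by (rule tendsto_eventually, rule eventually_sequentiallyI[of "Suc j"]) auto
  then have "limitin (product_topology (\<lambda>_. euclidean) UNIV)
      (\<lambda>n j. w j + (if j < n then a j else 0)) (\<lambda>j. w j + a j) sequentially"
    by (simp add: limitin_componentwise)
  then show ?thesis
    by (simp add: euclidean_product_topology)
qed

text \<open>The second moments of the finite likelihood ratios are bounded uniformly in
  \<open>n\<close>, which makes the ratios uniformly integrable. Restricting to open sets lets the
  bound survive the limit of the finite translates.\<close>

lemma emeasure_laplace_seq_shift_open_le:
  fixes a :: "nat \<Rightarrow> real"
  defines "b \<equiv> \<lambda>j. (exp (sqrt 2 * \<bar>a j\<bar>) - 1)\<^sup>2"
  assumes b: "summable b" and U: "open U" and t: "0 < t"
  shows "emeasure (distr laplace_seq borel (\<lambda>w j. w j + a j)) U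
    \<le> ennreal t * emeasure laplace_seq U + ennreal (exp (suminf b) / t)"
proof -
  let ?R = "ennreal t * emeasure laplace_seq U + ennreal (exp (suminf b) / t)"
  have [measurable]: "U \<in> sets borel" using U by simp
  define S where "S n w j = w j + (if j < n then a j else 0)" for n and w :: "nat \<Rightarrow> real" and j
  have S [measurable]: "S n \<in> borel_measurable borel" for n
    unfolding S_def [abs_def] by (rule measurable_seq_add)
  define q where "q n w = (\<Prod>j<n. lratio (a j) (w j))" for n and w :: "nat \<Rightarrow> real"
  have [measurable]: "q n \<in> borel_measurable borel" for n unfolding q_def [abs_def] by measurable
  have q0: "0 \<le> q n w" for n w by (simp add: q_def prod_nonneg lratio_pos less_imp_le)
  have q2: "(\<integral>\<^sup>+w. ennreal ((q n w)\<^sup>2) \<partial>laplace_seq) \<le> ennreal (exp (suminf b))" for n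
  proof -
    have "(\<integral>\<^sup>+w. ennreal ((q n w)\<^sup>2) \<partial>laplace_seq)
        = (\<integral>\<^sup>+w. (\<Prod>j<n. ennreal ((lratio (a j) (w j))\<^sup>2)) \<partial>laplace_seq)"
      by (simp add: q_def prod_ennreal prod_power_distrib)
    also have "\<dots> = (\<Prod>j<n. \<integral>\<^sup>+x. ennreal ((lratio (a j) x)\<^sup>2) \<partial>laplace)"
      by (rule nn_integral_laplace_seq_prod) auto
    also have "\<dots> \<le> (\<Prod>j<n. ennreal (exp (b j)))"
      unfolding b_def by (intro prod_mono_ennreal nn_integral_lratio_power2_le)
    also have "\<dots> = ennreal (exp (\<Sum>j<n. b j))"
      by (simp add: prod_ennreal exp_sum)
    also have "\<dots> \<le> ennreal (exp (suminf b))"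
      using b by (intro ennreal_leI) (auto intro!: sum_le_suminf simp: b_def)
    finally show ?thesis .
  qed
  have fin: "(\<integral>\<^sup>+w. indicator U (S n w) \<partial>laplace_seq) \<le> ?R" for n
  proof -
    have "(\<integral>\<^sup>+w. indicator U (S n w) \<partial>laplace_seq) = emeasure (distr laplace_seq borel (S n)) U"
      by (simp add: nn_integral_distr flip: nn_integral_indicator)
    also have "distr laplace_seq borel (S n) = density laplace_seq (\<lambda>w. ennreal (q n w))"
      unfolding S_def [abs_def] distr_laplace_seq_finite_shift q_def
      by (simp add: prod_ennreal lratio_pos less_imp_le)
    also have "emeasure \<dots> U = (\<integral>\<^sup>+w. ennreal (q n w) * indicator U w \<partial>laplace_seq)"
      by (simp add: emeasure_density)
    also have "\<dots> \<le> (\<integral>\<^sup>+w. ennreal t * indicator U w + ennreal (1 / t) * ennreal ((q n w)\<^sup>2) \<partial>laplace_seq)"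
    proof (rule nn_integral_mono)
      fix w
      \<comment> \<open>Truncation at level \<open>t\<close>: below it the first term dominates,
        above it the second.\<close>
      have "q n w \<le> t + 1 / t * (q n w)\<^sup>2"
      proof (cases "q n w \<le> t")
        case True
        then show ?thesis using t by (simp add: add_increasing2)
      next
        case False
        then have "t * q n w \<le> q n w * q n w" using q0 by (intro mult_right_mono) auto
        then have "q n w \<le> 1 / t * (q n w)\<^sup>2" using t by (simp add: field_simps power2_eq_square)
        then show ?thesis using t by simp
      qed
      then have "ennreal (q n w) \<le> ennreal t + ennreal (1 / t) * ennreal ((q n w)\<^sup>2)"
        using t by (simp add: ennreal_leI flip: ennreal_plus ennreal_mult)
      then show "ennreal (q n w) * indicator U w
          \<le> ennreal t * indicator U w + ennreal (1 / t) * ennreal ((q n w)\<^sup>2)"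
        by (simp split: split_indicator)
    qed
    also have "\<dots> = ennreal t * emeasure laplace_seq U
        + ennreal (1 / t) * (\<integral>\<^sup>+w. ennreal ((q n w)\<^sup>2) \<partial>laplace_seq)"
      by (subst nn_integral_add) (auto simp: nn_integral_cmult)
    also have "\<dots> \<le> ennreal t * emeasure laplace_seq U + ennreal (1 / t) * ennreal (exp (suminf b))"
      by (intro add_left_mono mult_left_mono q2) auto
    also have "\<dots> = ?R"
      using t by (simp flip: ennreal_mult)
    finally show ?thesis .
  qed
  have "emeasure (distr laplace_seq borel (\<lambda>w j. w j + a j)) U
      = (\<integral>\<^sup>+w. indicator U (\<lambda>j. w j + a j) \<partial>laplace_seq)"
    by (simp add: nn_integral_distr flip: nn_integral_indicator)
  \<comment> \<open>If the full translate of \<open>w\<close> lies in the open set \<open>U\<close>,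
    so do its finite translates from some \<open>n\<close> on. Fatou's lemma then applies.\<close>
  also have "\<dots> \<le> (\<integral>\<^sup>+w. liminf (\<lambda>n. indicator U (S n w)) \<partial>laplace_seq)"
  proof (rule nn_integral_mono)
    fix w
    show "indicator U (\<lambda>j. w j + a j) \<le> liminf (\<lambda>n. indicator U (S n w) :: ennreal)"
    proof (cases "(\<lambda>j. w j + a j) \<in> U")
      case True
      then have "eventually (\<lambda>n. S n w \<in> U) sequentially"
        using topological_tendstoD[OF tendsto_finite_shift U] by (simp add: S_def [abs_def])
      then have "1 \<le> liminf (\<lambda>n. indicator U (S n w) :: ennreal)"
        by (intro Liminf_bounded) (auto elim: eventually_mono)
      then show ?thesis using True by simp
    qed simp
  qed
  also have "\<dots> \<le> liminf (\<lambda>n. \<integral>\<^sup>+w. indicator U (S n w) \<partial>laplace_seq)"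
    by (rule nn_integral_liminf) measurable
  also have "\<dots> \<le> liminf (\<lambda>n::nat. ?R)"
    by (rule Liminf_mono) (auto simp: fin)
  also have "\<dots> = ?R"
    by (rule Liminf_const) simp
  finally show ?thesis .
qed

lemma absolutely_continuous_laplace_seq_shift:
  assumes "summable (\<lambda>j. (a j)\<^sup>2)"
  shows "absolutely_continuous laplace_seq (distr laplace_seq borel (\<lambda>w j. w j + a j))"
proof -
  define b where "b j = (exp (sqrt 2 * \<bar>a j\<bar>) - 1)\<^sup>2" for j
  have "(\<lambda>j. sqrt 2 * sqrt ((a j)\<^sup>2)) \<longlonglongrightarrow> sqrt 2 * sqrt 0"
    by (intro tendsto_intros summable_LIMSEQ_zero assms)
  \<comment> \<open>Up to 1/2 the exponential satisfies \<open>exp t \<le> 1 + 2 * t\<close>, so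
    \<open>b j\<close> is eventually at most a multiple of the square of \<open>a j\<close>.\<close>
  from order_tendstoD(2)[OF this, of "1/2"] have "eventually (\<lambda>j. sqrt 2 * \<bar>a j\<bar> < 1/2) sequentially"
    by simp
  then have "eventually (\<lambda>j. norm (b j) \<le> 8 * (a j)\<^sup>2) sequentially"
  proof eventually_elim
    case (elim j)
    have "exp (sqrt 2 * \<bar>a j\<bar>) \<le> 1 + 2 * (sqrt 2 * \<bar>a j\<bar>)"
      using exp_bound_lemma[of "sqrt 2 * \<bar>a j\<bar>"] elim by simp
    then have "b j \<le> (2 * (sqrt 2 * \<bar>a j\<bar>))\<^sup>2"
      unfolding b_def by (intro power_mono) auto
    also have "\<dots> = 8 * (a j)\<^sup>2" by (simp add: power_mult_distrib)
    finally show ?case by (simp add: b_def)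
  qed
  then have b: "summable b"
    by (rule summable_comparison_test_ev) (intro summable_mult assms)
  show ?thesis
    unfolding absolutely_continuous_def
  proof
    fix B assume "B \<in> null_sets laplace_seq"
    then have [measurable]: "B \<in> sets borel" and B0: "emeasure laplace_seq B = 0" by auto
    let ?P = "distr laplace_seq borel (\<lambda>w j. w j + a j)"
    have le: "emeasure ?P B \<le> 0 + ennreal e" if e: "0 < e" for e
    proof -
      \<comment> \<open>This \<open>t\<close> makes the second term of the bound
        \<open>e / 2\<close>; taking \<open>U\<close> of measure below \<open>e / (2 * t)\<close>
        makes the first at most \<open>e / 2\<close>.\<close>
      define t where "t = 2 * exp (suminf b) / e"
      have t: "0 < t" using e by (simp add: t_def)
      have "(INF U\<in>{U. B \<subseteq> U \<and> open U}. emeasure laplace_seq U) < ennreal (e / (2 * t))"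
        using outer_regular[of laplace_seq B] B0 e t by simp
      then obtain U where U: "B \<subseteq> U" "open U" "emeasure laplace_seq U < ennreal (e / (2 * t))"
        by (auto simp: INF_less_iff)
      have "emeasure ?P B \<le> emeasure ?P U"
        using U by (intro emeasure_mono) auto
      also have "\<dots> \<le> ennreal t * emeasure laplace_seq U + ennreal (exp (suminf b) / t)"
        using emeasure_laplace_seq_shift_open_le[of a U t] b U(2) t by (simp add: b_def [abs_def])
      also have "\<dots> \<le> ennreal t * ennreal (e / (2 * t)) + ennreal (exp (suminf b) / t)"
        using U(3) by (intro add_right_mono mult_left_mono) auto
      also have "\<dots> = ennreal (t * (e / (2 * t)) + exp (suminf b) / t)"
        using t e by (subst ennreal_plus) (auto simp flip: ennreal_mult)
      also have "t * (e / (2 * t)) + exp (suminf b) / t = e"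
        using t e by (simp add: t_def)
      finally show ?thesis by simp
    qed
    have "emeasure ?P B \<le> 0" by (rule ennreal_le_epsilon) (rule le)
    then show "B \<in> null_sets ?P" by (simp add: null_sets_def)
  qed
qed

section \<open>Translates by sequences that are not square summable\<close>

lemma summable_power2_if_summable_one_minus_exp:
  fixes a :: "nat \<Rightarrow> real"
  assumes "summable (\<lambda>j. (1 - exp (- \<bar>a j\<bar> / sqrt 2))\<^sup>2)"
  shows "summable (\<lambda>j. (a j)\<^sup>2)"
proof -
  have "(\<lambda>j. sqrt ((1 - exp (- \<bar>a j\<bar> / sqrt 2))\<^sup>2)) \<longlonglongrightarrow> sqrt 0"
    by (intro tendsto_intros summable_LIMSEQ_zero assms)
  then have "eventually (\<lambda>j. 1 - exp (- \<bar>a j\<bar> / sqrt 2) < 1/2) sequentially"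
    by (intro order_tendstoD(2)) auto
  \<comment> \<open>With \<open>t = \<bar>a j\<bar> / sqrt 2\<close>, the inequality
    \<open>1 + t \<le> exp t\<close> gives \<open>t * exp (- t) \<le> 1 - exp (- t)\<close>. Since
    \<open>exp (- t)\<close> exceeds 1/2, \<open>t\<close> is at most twice the right side; squaring
    yields the factor 8.\<close>
  then have "eventually (\<lambda>j. norm ((a j)\<^sup>2) \<le> 8 * (1 - exp (- \<bar>a j\<bar> / sqrt 2))\<^sup>2) sequentially"
  proof eventually_elim
    case (elim j)
    define t where "t = \<bar>a j\<bar> / sqrt 2"
    have t: "0 \<le> t" and at: "(a j)\<^sup>2 = 2 * t\<^sup>2" by (auto simp: t_def power_divide)
    have e: "1/2 < exp (- t)" using elim by (simp add: t_def)
    have "(1 + t) * exp (- t) \<le> exp t * exp (- t)"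
      by (intro mult_right_mono exp_ge_add_one_self) auto
    then have "t * exp (- t) \<le> 1 - exp (- t)" by (simp add: exp_minus field_simps)
    moreover have "t * (1/2) \<le> t * exp (- t)" using e t by (intro mult_left_mono) auto
    ultimately have "t \<le> 2 * (1 - exp (- t))" by simp
    then have "t\<^sup>2 \<le> (2 * (1 - exp (- t)))\<^sup>2" using t by (rule power_mono)
    then have "(a j)\<^sup>2 \<le> 8 * (1 - exp (- t))\<^sup>2"
      unfolding at power_mult_distrib by simp
    then show ?case by (simp add: t_def)
  qed
  then show ?thesis
    by (rule summable_comparison_test_ev) (intro summable_mult assms)
qed

lemma summable_if_absolutely_continuous_laplace_seq_shift:
  assumes ac: "absolutely_continuous laplace_seq (distr laplace_seq borel (\<lambda>w j. w j + a j))"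
  shows "summable (\<lambda>j. (a j)\<^sup>2)"
proof (rule ccontr)
  assume not_summable: "\<not> summable (\<lambda>j. (a j)\<^sup>2)"
  define b where "b j = (1 - exp (- \<bar>a j\<bar> / sqrt 2))\<^sup>2 / 4" for j
  have b0: "0 \<le> b j" for j by (simp add: b_def)
  have "\<not> summable b"
    using not_summable summable_power2_if_summable_one_minus_exp[of a] summable_mult[of b 4]
    by (auto simp: b_def [abs_def])
  \<comment> \<open>The partial sums of \<open>b\<close> are unbounded, so \<open>m k\<close>
    coordinates suffice to push the affinity below \<open>exp (- k)\<close>, the term of a
    convergent geometric series.\<close>
  then have "\<exists>n. real k \<le> (\<Sum>j<n. b j)" for k
    using summableI_nonneg_bounded[of b "real k"] b0 by (meson linear)
  then obtain m where m: "\<And>k. real k \<le> (\<Sum>j<m k. b j)" by metis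
  define F where "F c k w = (\<Prod>j<m k. ennreal (sqrt_lratio (c j) (w j)))"
    for c :: "nat \<Rightarrow> real" and k and w :: "nat \<Rightarrow> real"
  have [measurable]: "F c k \<in> borel_measurable borel" for c k unfolding F_def [abs_def] by measurable
  \<comment> \<open>The affinity bound depends only on absolute values, so the claim serves both
    \<open>a\<close> and its negative.\<close>
  have F_fin: "AE w in laplace_seq. (\<Sum>k. F c k w) \<noteq> \<infinity>" if c: "\<And>j. \<bar>c j\<bar> = \<bar>a j\<bar>" for c
  proof (rule nn_integral_PInf_AE)
    have le: "(\<integral>\<^sup>+w. F c k w \<partial>laplace_seq) \<le> ennreal (exp (-1) ^ k)" for k
    proof -
      have "(\<integral>\<^sup>+w. F c k w \<partial>laplace_seq) = (\<Prod>j<m k. \<integral>\<^sup>+x. ennreal (sqrt_lratio (c j) x) \<partial>laplace)"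
        unfolding F_def by (rule nn_integral_laplace_seq_prod) auto
      also have "\<dots> \<le> (\<Prod>j<m k. ennreal (exp (- b j)))"
        using nn_integral_sqrt_lratio_le[of "c j" for j] c by (intro prod_mono_ennreal) (simp add: b_def)
      also have "\<dots> = ennreal (exp (- (\<Sum>j<m k. b j)))"
        by (simp add: prod_ennreal exp_sum flip: sum_negf)
      also have "\<dots> \<le> ennreal (exp (-1) ^ k)"
        using m[of k] by (intro ennreal_leI) (simp flip: exp_of_nat_mult)
      finally show ?thesis .
    qed
    have "(\<integral>\<^sup>+w. (\<Sum>k. F c k w) \<partial>laplace_seq) = (\<Sum>k. \<integral>\<^sup>+w. F c k w \<partial>laplace_seq)"
      by (rule nn_integral_suminf) measurable
    also have "\<dots> \<le> (\<Sum>k. ennreal (exp (-1) ^ k))"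
      by (intro suminf_le le) auto
    also have "\<dots> < \<infinity>"
      by (subst suminf_ennreal2) (auto intro!: summable_geometric)
    finally show "(\<integral>\<^sup>+w. (\<Sum>k. F c k w) \<partial>laplace_seq) \<noteq> \<infinity>" by simp
  qed measurable
  \<comment> \<open>Absolute continuity enters here: it carries the almost sure convergence for
    \<open>a\<close> over to the translated law.\<close>
  have "AE w in distr laplace_seq borel (\<lambda>w j. w j + a j). (\<Sum>k. F a k w) \<noteq> \<infinity>"
    by (rule absolutely_continuous_AE[OF _ ac]) (simp, rule F_fin, simp)
  then have "AE w in laplace_seq. (\<Sum>k. F a k (\<lambda>j. w j + a j)) \<noteq> \<infinity>"
    by (subst (asm) AE_distr_iff) auto
  moreover have "AE w in laplace_seq. (\<Sum>k. F (\<lambda>j. - a j) k w) \<noteq> \<infinity>"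
    by (rule F_fin) simp
  ultimately have "AE w in laplace_seq. False"
  proof eventually_elim
    case (elim w)
    let ?f = "\<lambda>k. F a k (\<lambda>j. w j + a j)" and ?g = "\<lambda>k. F (\<lambda>j. - a j) k w"
    have fg: "?f k * ?g k = 1" for k
      unfolding F_def prod.distrib[symmetric]
      by (rule prod.neutral) (simp add: sqrt_lratio_shift sqrt_lratio_pos less_imp_le flip: ennreal_mult)
    \<comment> \<open>Two nonnegative numbers with product 1 cannot both be below 1. Every term of
      the combined series is therefore at least 1, although its sum is finite.\<close>
    have ge: "1 \<le> ?f k + ?g k" for k
    proof (rule ccontr)
      assume "\<not> 1 \<le> ?f k + ?g k"
      then have less: "?f k + ?g k < 1" by simp
      then have "?f k \<le> 1" "?g k < 1"
        using le_less_trans[OF _ less, of "?f k"] le_less_trans[OF _ less, of "?g k"] by auto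
      then have "?f k * ?g k < 1" using mult_right_mono[of "?f k" 1 "?g k"] by (auto dest: le_less_trans)
      then show False by (simp add: fg)
    qed
    have "of_nat n \<le> (\<Sum>k. ?f k + ?g k)" for n
    proof -
      have "of_nat n = (\<Sum>k<n. 1 :: ennreal)" by simp
      also have "\<dots> \<le> (\<Sum>k<n. ?f k + ?g k)" by (intro sum_mono ge)
      also have "\<dots> \<le> (\<Sum>k. ?f k + ?g k)" by (rule sum_le_suminf) auto
      finally show ?thesis .
    qed
    moreover have "(\<Sum>k. ?f k + ?g k) \<noteq> top"
      using elim by (simp add: suminf_add[symmetric])
    then obtain n where "(\<Sum>k. ?f k + ?g k) < of_nat n"
      by (auto simp: less_top dest: ennreal_Ex_less_of_nat)
    ultimately show False
      by (meson leD)
  qed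
  then show False by simp
qed

section \<open>Reduction of the Hilbert space to coordinates\<close>

lemma onb_inner:
  assumes "orthonormal_basis phi"
  shows "phi i \<bullet> phi j = (if i = j then 1 else 0)"
  using assms by (simp add: orthonormal_basis_def)

definition onb_proj :: "(nat \<Rightarrow> 'a::real_inner) \<Rightarrow> nat \<Rightarrow> 'a \<Rightarrow> 'a" where
  "onb_proj phi n x = (\<Sum>j<n. (x \<bullet> phi j) *\<^sub>R phi j)"

lemma onb_proj_add: "onb_proj phi n (x + y) = onb_proj phi n x + onb_proj phi n y"
  by (simp add: onb_proj_def inner_add_left scaleR_add_left sum.distrib)

lemma onb_proj_diff: "onb_proj phi n (x - y) = onb_proj phi n x - onb_proj phi n y"
  by (simp add: onb_proj_def inner_diff_left scaleR_diff_left sum_subtractf)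

lemma onb_proj_scaleR: "onb_proj phi n (c *\<^sub>R x) = c *\<^sub>R onb_proj phi n x"
  by (simp add: onb_proj_def scaleR_sum_right)

text \<open>The residual \<open>x - ?p\<close> is orthogonal to \<open>?p\<close>, so Cauchy-Schwarz
  applied to \<open>x\<close> and \<open>?p\<close> gives the bound.\<close>

lemma norm_onb_proj_le:
  assumes "orthonormal_basis phi"
  shows "norm (onb_proj phi n x) \<le> norm x"
proof -
  let ?p = "onb_proj phi n x"
  have "?p \<bullet> phi j = x \<bullet> phi j" if "j < n" for j
    using that by (simp add: onb_proj_def inner_sum_left onb_inner[OF assms] if_distrib[of "(*) _"] cong: if_cong)
  then have "(x - ?p) \<bullet> ?p = 0"
    by (simp add: onb_proj_def[of phi n x] inner_sum_right inner_diff_left)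
  then have "x \<bullet> ?p = ?p \<bullet> ?p" by (simp add: inner_diff_left)
  then have "norm ?p * norm ?p \<le> norm x * norm ?p"
    using norm_cauchy_schwarz[of x ?p] by (simp add: dot_square_norm power2_eq_square)
  then show ?thesis
    by (cases "norm ?p = 0") (auto simp: mult_le_cancel_right)
qed

lemma onb_proj_eventually_eq:
  assumes "orthonormal_basis phi" "s \<in> span (range phi)"
  shows "eventually (\<lambda>n. onb_proj phi n s = s) sequentially"
  using assms(2)
proof (induction rule: span_induct_alt)
  case base
  then show ?case by (simp add: onb_proj_def)
next
  case (step c x y)
  then obtain i where i: "x = phi i" by auto
  have *: "onb_proj phi n x = x" if "i < n" for n
    using that
    by (simp add: onb_proj_def i onb_inner[OF assms(1)] if_distrib[of "\<lambda>c. c *\<^sub>R _"] cong: if_cong)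
  from step.IH eventually_gt_at_top[of i] show ?case
    by eventually_elim (simp add: onb_proj_add onb_proj_scaleR *)
qed

text \<open>On the dense span the projections eventually act as the identity; being contractions
  uniformly in \<open>n\<close>, they converge everywhere.\<close>

lemma onb_proj_tendsto:
  assumes "orthonormal_basis phi"
  shows "(\<lambda>n. onb_proj phi n x) \<longlonglongrightarrow> x"
proof (rule metric_LIMSEQ_I)
  fix r :: real assume r: "0 < r"
  have "x \<in> closure (span (range phi))"
    using assms by (simp add: orthonormal_basis_def)
  then obtain s where s: "s \<in> span (range phi)" "dist s x < r / 2"
    unfolding closure_approachable using r half_gt_zero by blast
  obtain N where N: "\<And>n. N \<le> n \<Longrightarrow> onb_proj phi n s = s"
    using onb_proj_eventually_eq[OF assms s(1)] by (auto simp: eventually_sequentially)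
  have "dist (onb_proj phi n x) x < r" if "N \<le> n" for n
  proof -
    have eq: "onb_proj phi n x - x = onb_proj phi n (x - s) + (s - x)"
      using N[OF that] by (simp add: onb_proj_diff)
    have "norm (onb_proj phi n x - x) \<le> norm (x - s) + norm (s - x)"
      unfolding eq
      using norm_triangle_ineq[of "onb_proj phi n (x - s)" "s - x"] norm_onb_proj_le[OF assms, of n "x - s"]
      by linarith
    then show ?thesis using s(2) by (simp add: dist_norm norm_minus_commute)
  qed
  then show "\<exists>N. \<forall>n\<ge>N. dist (onb_proj phi n x) x < r" by blast
qed

text \<open>The type is not of class \<open>second_countable_topology\<close>. Instead, the distance of \<open>x\<close> to a closed
  set is the limit of the distances of its finite-dimensional projections, each a continuous
  function of finitely many coordinates.\<close>
lemma borel_sets_eq_vimage_coordinates: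
  fixes phi :: "nat \<Rightarrow> 'a::real_inner" and c :: "nat \<Rightarrow> real"
  assumes onb: "orthonormal_basis phi" and c: "\<And>j. c j \<noteq> 0" and A: "A \<in> sets (borel :: 'a measure)"
  shows "\<exists>B\<in>sets borel. A = (\<lambda>x j. ((x - g) \<bullet> phi j) / c j) -` B"
proof -
  define Psi where "Psi x j = ((x - g) \<bullet> phi j) / c j" for x j
  let ?V = "vimage_algebra UNIV Psi (borel :: (nat \<Rightarrow> real) measure)"
  have Psi_meas: "Psi \<in> measurable ?V borel"
    by (rule measurable_vimage_algebra1) simp
  \<comment> \<open>Measurability of the identity says that every Borel set belongs to the
    sigma-algebra generated by the coordinates.\<close>
  have "(\<lambda>x. x) \<in> borel_measurable ?V"
  proof (rule borel_measurableI)
    fix S :: "'a set" assume S: "open S"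
    show "(\<lambda>x. x) -` S \<inter> space ?V \<in> sets ?V"
    \<comment> \<open>The distance to the empty set is 0 by convention, so \<open>S = UNIV\<close>
      is treated separately.\<close>
    proof (cases "S = UNIV")
      case True
      then show ?thesis using sets.top[of ?V] by simp
    next
      case False
      define G where "G n y = infdist (g + (\<Sum>j<n. (c j * y j) *\<^sub>R phi j)) (- S)"
        for n and y :: "nat \<Rightarrow> real"
      have [measurable]: "G n \<in> borel_measurable borel" for n
        unfolding G_def [abs_def]
        by (intro borel_measurable_continuous_onI continuous_intros) auto
      have "G n (Psi x) = infdist (g + onb_proj phi n (x - g)) (- S)" for n x
        using c by (simp add: G_def Psi_def onb_proj_def)
      moreover have "(\<lambda>n. infdist (g + onb_proj phi n (x - g)) (- S)) \<longlonglongrightarrow> infdist (g + (x - g)) (- S)" for x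
        by (intro tendsto_intros onb_proj_tendsto onb)
      ultimately have lim: "(\<lambda>n. G n (Psi x)) \<longlonglongrightarrow> infdist x (- S)" for x
        by simp
      have "(\<lambda>x. G n (Psi x)) \<in> borel_measurable ?V" for n
        by (rule measurable_compose[OF Psi_meas]) measurable
      then have meas: "(\<lambda>x. infdist x (- S)) \<in> borel_measurable ?V"
        by (rule borel_measurable_LIMSEQ_real[rotated]) (rule lim)
      have "S = (\<lambda>x. infdist x (- S)) -` {0<..}"
      proof -
        have "x \<in> - S \<longleftrightarrow> infdist x (- S) = 0" for x
          using S False by (intro in_closed_iff_infdist_zero) auto
        then show ?thesis using infdist_nonneg[of _ "- S"] by (force simp: less_le)
      qed
      then show ?thesis
        using measurable_sets[OF meas, of "{0<..}"] by simp
    qed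
  qed
  from measurable_sets[OF this A] have "A \<in> sets ?V" by simp
  then show ?thesis
    by (subst (asm) sets_vimage_algebra2) (auto simp: Psi_def [abs_def])
qed

text \<open>A set is null for an image measure iff its preimage is null. By \<open>gen\<close> every
  Borel set is such a preimage, so no null set is lost in the image.\<close>

lemma absolutely_continuous_distr_iff:
  assumes [measurable]: "T \<in> borel_measurable borel"
    and sets: "sets P = sets borel" "sets Q = sets borel"
    and gen: "\<And>A. A \<in> sets borel \<Longrightarrow> \<exists>B\<in>sets borel. A = T -` B"
  shows "absolutely_continuous (distr P borel T) (distr Q borel T) \<longleftrightarrow> absolutely_continuous P Q"
proof -
  have *: "B \<in> null_sets (distr R borel T) \<longleftrightarrow> T -` B \<in> null_sets R"
    if B: "B \<in> sets borel" and R: "sets R = sets borel" for B R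
  proof -
    have m: "T \<in> borel_measurable R"
      using assms(1) by (simp add: measurable_cong_sets[OF R refl])
    have "space R = UNIV" using R[THEN sets_eq_imp_space_eq] by simp
    then show ?thesis
      using B measurable_sets[OF m B] by (auto simp: null_sets_def emeasure_distr[OF m])
  qed
  show ?thesis
  proof
    assume ac: "absolutely_continuous (distr P borel T) (distr Q borel T)"
    show "absolutely_continuous P Q"
      unfolding absolutely_continuous_def
    proof
      fix A assume A: "A \<in> null_sets P"
      then have "A \<in> sets borel" using sets by auto
      then obtain B where B: "B \<in> sets borel" "A = T -` B" using gen by blast
      then have "B \<in> null_sets (distr P borel T)" using A * sets by blast
      then have "B \<in> null_sets (distr Q borel T)" using ac by (auto simp: absolutely_continuous_def)
      then show "A \<in> null_sets Q" using B * sets by blast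
    qed
  next
    assume ac: "absolutely_continuous P Q"
    show "absolutely_continuous (distr P borel T) (distr Q borel T)"
      unfolding absolutely_continuous_def
    proof
      fix B assume B: "B \<in> null_sets (distr P borel T)"
      then have "B \<in> sets borel" by auto
      with B ac show "B \<in> null_sets (distr Q borel T)"
        using * sets by (auto simp: absolutely_continuous_def)
    qed
  qed
qed

section \<open>From the process to its coordinates\<close>

lemma ICLP_coordinates:
  assumes "ICLP M lam phi 0 Z"
  obtains Zs where "\<And>j. Zs j \<in> borel_measurable M"
    and "distr M borel (\<lambda>\<omega> j. Zs j \<omega>) = laplace_seq"
    and "AE \<omega> in M. \<forall>j. Z \<omega> \<bullet> phi j = sqrt (lam j) * Zs j \<omega>"
proof -
  from assms obtain Zs where P: "prob_space M" and cov: "covariance_spectral lam phi"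
    and Z: "Z \<in> borel_measurable M"
    and indep: "prob_space.indep_vars M (\<lambda>_. borel) Zs UNIV"
    and lap: "\<And>j. distributed M lborel (Zs j) laplace_density"
    and lim: "(\<lambda>n. \<integral>\<^sup>+ \<omega>. ennreal ((norm (Z \<omega> - (0 + (\<Sum>j<n. (sqrt (lam j) * Zs j \<omega>) *\<^sub>R phi j))))\<^sup>2) \<partial>M)
          \<longlonglongrightarrow> 0"
    unfolding ICLP_def by blast
  interpret prob_space M by fact
  have onb: "orthonormal_basis phi" using cov by (simp add: covariance_spectral_def)
  have Zs [measurable]: "Zs j \<in> borel_measurable M" for j
    using distributed_measurable[OF lap[of j]] by simp
  have Zinner [measurable]: "(\<lambda>\<omega>. Z \<omega> \<bullet> phi j) \<in> borel_measurable M" for j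
    by (rule measurable_compose[OF Z]) (intro borel_measurable_continuous_onI continuous_intros)
  have dist: "distr M borel (Zs j) = laplace" for j
    using distributed_distr_eq_density[OF lap[of j]] unfolding laplace_def
    by (metis distr_cong sets_lborel)
  have "distr M borel (\<lambda>\<omega> j. Zs j \<omega>) = distr M (Pi\<^sub>M UNIV (\<lambda>_. borel)) (\<lambda>\<omega>. \<lambda>j\<in>UNIV. Zs j \<omega>)"
    by (rule distr_cong) (auto simp: sets_PiM_equal_borel)
  also have "\<dots> = Pi\<^sub>M UNIV (\<lambda>j. distr M borel (Zs j))"
    using indep by (subst (asm) indep_vars_iff_distr_eq_PiM) auto
  also have "\<dots> = laplace_seq"
    by (simp add: dist laplace_seq_def)
  finally have law: "distr M borel (\<lambda>\<omega> j. Zs j \<omega>) = laplace_seq" .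
  have "AE \<omega> in M. Z \<omega> \<bullet> phi j = sqrt (lam j) * Zs j \<omega>" for j
  proof -
    let ?I = "\<integral>\<^sup>+ \<omega>. ennreal ((Z \<omega> \<bullet> phi j - sqrt (lam j) * Zs j \<omega>)\<^sup>2) \<partial>M"
    \<comment> \<open>Once \<open>n\<close> exceeds \<open>j\<close>, the coordinate
      \<open>j\<close> of the truncation error no longer depends on \<open>n\<close>, and it is at
      most the norm of the error. Mean square convergence then forces it to vanish almost
      surely.\<close>
    have "?I \<le> (\<integral>\<^sup>+ \<omega>. ennreal ((norm (Z \<omega> - (0 + (\<Sum>j<n. (sqrt (lam j) * Zs j \<omega>) *\<^sub>R phi j))))\<^sup>2) \<partial>M)"
      if "j < n" for n
    proof (intro nn_integral_mono ennreal_leI)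
      fix \<omega>
      let ?d = "Z \<omega> - (0 + (\<Sum>j<n. (sqrt (lam j) * Zs j \<omega>) *\<^sub>R phi j))"
      have "?d \<bullet> phi j = Z \<omega> \<bullet> phi j - sqrt (lam j) * Zs j \<omega>"
        using that by (simp add: inner_diff_left inner_sum_left onb_inner[OF onb] if_distrib[of "(*) _"] cong: if_cong)
      moreover have "\<bar>?d \<bullet> phi j\<bar> \<le> norm ?d"
        using Cauchy_Schwarz_ineq2[of ?d "phi j"] onb_inner[OF onb, of j j] by (simp add: norm_eq_sqrt_inner)
      ultimately show "(Z \<omega> \<bullet> phi j - sqrt (lam j) * Zs j \<omega>)\<^sup>2 \<le> (norm ?d)\<^sup>2"
        by (metis abs_ge_zero power2_abs power_mono)
    qed
    then have "?I \<le> 0"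
      by (intro tendsto_lowerbound[OF lim]) (auto intro: eventually_mono[OF eventually_gt_at_top[of j]])
    then have "AE \<omega> in M. ennreal ((Z \<omega> \<bullet> phi j - sqrt (lam j) * Zs j \<omega>)\<^sup>2) = 0"
      by (subst nn_integral_0_iff_AE[symmetric]) auto
    then show ?thesis
      by eventually_elim (simp add: ennreal_eq_0_iff)
  qed
  then have "AE \<omega> in M. \<forall>j. Z \<omega> \<bullet> phi j = sqrt (lam j) * Zs j \<omega>"
    by (simp add: AE_all_countable)
  with Zs law show ?thesis by (rule that)
qed

text \<open>One direction of absolute continuity already characterises the condition. The condition
  is symmetric in \<open>f\<close> and \<open>g\<close>, so exchanging them gives the other
  direction.\<close>

lemma absolutely_continuous_ICLP_shift_iff:
  fixes phi :: "nat \<Rightarrow> 'a::{real_inner,complete_space}" and sigma :: real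
  assumes iclp: "ICLP M lam phi 0 Z" and sigma: "sigma > 0"
  shows "absolutely_continuous (distr M borel (\<lambda>\<omega>. g + sigma *\<^sub>R Z \<omega>)) (distr M borel (\<lambda>\<omega>. f + sigma *\<^sub>R Z \<omega>))
    \<longleftrightarrow> in_HC lam phi (f - g)"
proof -
  have onb: "orthonormal_basis phi" and lam: "\<And>j. lam j > 0" and Z: "Z \<in> borel_measurable M"
    using iclp by (auto simp: ICLP_def covariance_spectral_def)
  obtain Zs where Zs [measurable]: "\<And>j. Zs j \<in> borel_measurable M"
    and law: "distr M borel (\<lambda>\<omega> j. Zs j \<omega>) = laplace_seq"
    and coord: "AE \<omega> in M. \<forall>j. Z \<omega> \<bullet> phi j = sqrt (lam j) * Zs j \<omega>"
    using ICLP_coordinates[OF iclp] by blast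
  define c where "c j = sigma * sqrt (lam j)" for j
  have c: "c j \<noteq> 0" for j using lam[of j] sigma by (simp add: c_def)
  define a where "a j = ((f - g) \<bullet> phi j) / c j" for j
  define Psi where "Psi x j = ((x - g) \<bullet> phi j) / c j" for x j
  have Psi [measurable]: "Psi \<in> borel_measurable borel"
    unfolding Psi_def [abs_def]
    by (intro borel_measurable_continuous_onI continuous_intros) (use c in auto)
  have hZ: "(\<lambda>\<omega>. h + sigma *\<^sub>R Z \<omega>) \<in> borel_measurable M" for h
    by (rule measurable_compose[OF Z]) (intro borel_measurable_continuous_onI continuous_intros)
  have W: "(\<lambda>\<omega> j. Zs j \<omega>) \<in> borel_measurable M"
    by (rule measurable_coordinatewise_then_product) measurable
  have Wd: "(\<lambda>\<omega> j. Zs j \<omega> + d j) \<in> borel_measurable M" for d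
    by (rule measurable_coordinatewise_then_product) measurable
  \<comment> \<open>Coordinates are centred at \<open>g\<close>: \<open>h = g\<close> yields the
    untranslated product law and \<open>h = f\<close> its translate by \<open>a\<close>.\<close>
  have push: "distr (distr M borel (\<lambda>\<omega>. h + sigma *\<^sub>R Z \<omega>)) borel Psi
      = distr laplace_seq borel (\<lambda>w j. w j + ((h - g) \<bullet> phi j) / c j)" for h
  proof -
    have "distr (distr M borel (\<lambda>\<omega>. h + sigma *\<^sub>R Z \<omega>)) borel Psi
        = distr M borel (\<lambda>\<omega>. Psi (h + sigma *\<^sub>R Z \<omega>))"
      by (subst distr_distr[OF Psi hZ]) (simp add: comp_def)
    also have "\<dots> = distr M borel (\<lambda>\<omega> j. Zs j \<omega> + ((h - g) \<bullet> phi j) / c j)"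
    proof (rule distr_cong_AE)
      show "AE \<omega> in M. Psi (h + sigma *\<^sub>R Z \<omega>) = (\<lambda>j. Zs j \<omega> + ((h - g) \<bullet> phi j) / c j)"
        using coord
      proof eventually_elim
        case (elim \<omega>)
        show ?case
        proof
          fix j
          have "(h + sigma *\<^sub>R Z \<omega> - g) \<bullet> phi j = (h - g) \<bullet> phi j + c j * Zs j \<omega>"
            using elim by (simp add: c_def inner_add_left inner_diff_left)
          then show "Psi (h + sigma *\<^sub>R Z \<omega>) j = Zs j \<omega> + ((h - g) \<bullet> phi j) / c j"
            using c[of j] by (simp add: Psi_def add_divide_distrib)
        qed
      qed
    qed (auto intro: measurable_compose[OF hZ Psi] Wd)
    also have "\<dots> = distr laplace_seq borel (\<lambda>w j. w j + ((h - g) \<bullet> phi j) / c j)"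
      unfolding law[symmetric] by (subst distr_distr[OF measurable_seq_add W]) (simp add: comp_def)
    finally show ?thesis .
  qed
  have "absolutely_continuous (distr M borel (\<lambda>\<omega>. g + sigma *\<^sub>R Z \<omega>)) (distr M borel (\<lambda>\<omega>. f + sigma *\<^sub>R Z \<omega>))
      \<longleftrightarrow> absolutely_continuous (distr (distr M borel (\<lambda>\<omega>. g + sigma *\<^sub>R Z \<omega>)) borel Psi)
            (distr (distr M borel (\<lambda>\<omega>. f + sigma *\<^sub>R Z \<omega>)) borel Psi)"
    using borel_sets_eq_vimage_coordinates[OF onb c, of _ g]
    by (intro absolutely_continuous_distr_iff[symmetric]) (auto simp: Psi_def [abs_def] intro!: Psi[unfolded Psi_def [abs_def]])
  also have "\<dots> \<longleftrightarrow> absolutely_continuous laplace_seq (distr laplace_seq borel (\<lambda>w j. w j + a j))"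
  proof -
    have "distr laplace_seq borel (\<lambda>w. w) = laplace_seq"
      by (rule distr_id2) simp
    then show ?thesis by (simp add: push a_def)
  qed
  also have "\<dots> \<longleftrightarrow> summable (\<lambda>j. (a j)\<^sup>2)"
    by (rule iffI[OF summable_if_absolutely_continuous_laplace_seq_shift absolutely_continuous_laplace_seq_shift])
  also have "\<dots> \<longleftrightarrow> in_HC lam phi (f - g)"
  proof -
    have eq: "(a j)\<^sup>2 = (1 / sigma\<^sup>2) * (((f - g) \<bullet> phi j)\<^sup>2 / lam j)" for j
      using lam[of j] by (simp add: a_def c_def power_divide power_mult_distrib)
    show ?thesis
      unfolding in_HC_def eq using sigma by (subst summable_cmult_iff) auto
  qed
  finally show ?thesis .
qed

lemma in_HC_minus_commute: "in_HC lam phi (f - g) \<longleftrightarrow> in_HC lam phi (g - f)"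
  unfolding in_HC_def inner_diff_left by (subst power2_commute) (rule refl)

theorem theorem2:
  fixes M :: "'m measure" and lam :: "nat \<Rightarrow> real"
    and phi :: "nat \<Rightarrow> 'a::{real_inner,complete_space}"
    and Z :: "'m \<Rightarrow> 'a" and sigma :: real and f g :: 'a
  assumes "ICLP M lam phi 0 Z"
    and "sigma > 0"
  shows "equivalent_measures (distr M borel (\<lambda>\<omega>. f + sigma *\<^sub>R Z \<omega>))
                             (distr M borel (\<lambda>\<omega>. g + sigma *\<^sub>R Z \<omega>))
         \<longleftrightarrow> in_HC lam phi (f - g)"
  using absolutely_continuous_ICLP_shift_iff[OF assms] in_HC_minus_commute[of lam phi f g]
  by (simp add: equivalent_measures_def)

end
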